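(* Let $\nu\ge 0$ and $T>0$. Let $u_+,u_-:[0,T)\times\mathbb{R}^3\to\mathbb{R}^3$ be smooth divergence-free vector fields with $\nabla\times u_+=\Lambda u_+$ and $\nabla\times u_-=-\Lambda u_-$, solving the system $$ \begin{aligned} &\partial_t u_+-\nu\Delta u_+=P_+\left[(u_++u_-)\times(\Lambda u_+-\Lambda u_-)\right],\\ &\partial_t u_--\nu\Delta u_-=P_-\left[(u_++u_-)\times(\Lambda u_+-\Lambda u_-)\right] \end{aligned} $$ (which is the incompressible Navier-Stokes system, or the Euler system when $\nu=0$, written for the projections $u_\pm$ of the velocity $u=u_++u_-$ to the positive and negative spectrum of the curl operator). Then the system is invariant under the transformation $$u_+(t,x)\mapsto -u_-(t,-x),\qquad u_-(t,x)\mapsto -u_+(t,-x);$$ that is, the pair $(\tilde u_+,\tilde u_-)$ defined by $\tilde u_+(t,x)=-u_-(t,-x)$, $\tilde u_-(t,x)=-u_+(t,-x)$ consists of divergence-free fields satisfying $\nabla\times\tilde u_\pm=\pm\Lambda\tilde u_\pm$ and solves the same system on $[0,T)\times\mathbb{R}^3$.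
   Context: $\Lambda=\sqrt{-\Delta}$ is the Fourier multiplier with symbol $|\xi|$ on $\mathbb{R}^3$. For a vector field $\psi:\mathbb{R}^3\to\mathbb{R}^3$, $Q\psi=(-\Delta)^{-1}\nabla\times\nabla\times\psi$ is the projection onto divergence-free fields. For $\phi$ with $\nabla\cdot\phi=0$, $Q_\pm\phi=\frac12\left(\phi\pm\Lambda^{-1}\nabla\times\phi\right)$, and $P_\pm=Q_\pm Q$. Smooth fields are understood to be in $C([0,T);H^s(\mathbb{R}^3))$ for every $s\ge 0$, so that all operators are well defined. *)

theory Defs
  imports "HOL-Analysis.Analysis"
begin

section \<open>The Fourier transform on L2 and the Sobolev spaces\<close>

definition square_integrable :: "(real^3 \<Rightarrow> complex) \<Rightarrow> bool" where
  "square_integrable f \<longleftrightarrow>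
     f \<in> borel_measurable lborel \<and> integrable lborel (\<lambda>x. (norm (f x))\<^sup>2)"

definition truncated_fourier :: "real \<Rightarrow> (real^3 \<Rightarrow> complex) \<Rightarrow> real^3 \<Rightarrow> complex" where
  "truncated_fourier R f \<xi> =
     (1 / sqrt (2 * pi) ^ 3) *\<^sub>R (LINT x:cball 0 R|lborel. cis (- (x \<bullet> \<xi>)) * f x)"

text \<open>The unitary Fourier transform of an \<open>f\<close> in L2 is the L2 limit of the transforms of its
  truncations to balls. It is determined almost everywhere; \<open>fourier\<close> picks one representative.
  By Plancherel's theorem the limit exists for every \<open>f\<close> in L2, so the value 0 is only used
  outside L2.\<close>

definition is_fourier :: "(real^3 \<Rightarrow> complex) \<Rightarrow> (real^3 \<Rightarrow> complex) \<Rightarrow> bool" where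
  "is_fourier f g \<longleftrightarrow> square_integrable f \<and> square_integrable g \<and>
     ((\<lambda>R. \<integral>\<^sup>+\<xi>. ennreal ((norm (truncated_fourier R f \<xi> - g \<xi>))\<^sup>2) \<partial>lborel) \<longlongrightarrow> 0) at_top"

definition fourier :: "(real^3 \<Rightarrow> complex) \<Rightarrow> real^3 \<Rightarrow> complex" where
  "fourier f = (if \<exists>g. is_fourier f g then (SOME g. is_fourier f g) else (\<lambda>\<xi>. 0))"

definition inverse_fourier :: "(real^3 \<Rightarrow> complex) \<Rightarrow> real^3 \<Rightarrow> complex" where
  "inverse_fourier g x = (1 / sqrt (2 * pi) ^ 3) *\<^sub>R (LINT \<xi>|lborel. cis (x \<bullet> \<xi>) * g \<xi>)"

definition component :: "(real^3 \<Rightarrow> real^3) \<Rightarrow> 3 \<Rightarrow> real^3 \<Rightarrow> complex" where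
  "component f i = (\<lambda>x. complex_of_real (f x $ i))"

definition in_sobolev :: "real \<Rightarrow> (real^3 \<Rightarrow> real^3) \<Rightarrow> bool" where
  "in_sobolev s f \<longleftrightarrow> (\<forall>i. square_integrable (component f i) \<and>
     integrable lborel (\<lambda>\<xi>. (1 + (norm \<xi>)\<^sup>2) powr s * (norm (fourier (component f i) \<xi>))\<^sup>2))"

definition sobolev_norm :: "real \<Rightarrow> (real^3 \<Rightarrow> real^3) \<Rightarrow> real" where
  "sobolev_norm s f = sqrt (\<Sum>i\<in>UNIV.
     LINT \<xi>|lborel. (1 + (norm \<xi>)\<^sup>2) powr s * (norm (fourier (component f i) \<xi>))\<^sup>2)"

definition continuous_in_sobolev ::
    "real \<Rightarrow> real \<Rightarrow> (real \<Rightarrow> real^3 \<Rightarrow> real^3) \<Rightarrow> bool" where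
  "continuous_in_sobolev T s u \<longleftrightarrow> (\<forall>t\<in>{0..<T}. in_sobolev s (u t) \<and>
     ((\<lambda>r. sobolev_norm s (\<lambda>x. u r x - u t x)) \<longlongrightarrow> 0) (at t within {0..<T}))"


section \<open>Smooth fields\<close>

text \<open>On \<open>{0..<T} \<times> UNIV\<close>, which is convex with nonempty interior, the derivative \<open>D x\<close> within
  the set is unique.\<close>

primrec Ck_on :: "nat \<Rightarrow> 'a::real_normed_vector set \<Rightarrow> ('a \<Rightarrow> 'b::real_normed_vector) \<Rightarrow> bool" where
  "Ck_on 0 S f \<longleftrightarrow> continuous_on S f"
| "Ck_on (Suc k) S f \<longleftrightarrow> (\<exists>D. (\<forall>x\<in>S. (f has_derivative D x) (at x within S)) \<and>
     (\<forall>v. Ck_on k S (\<lambda>x. D x v)))"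

definition smooth_field :: "real \<Rightarrow> (real \<Rightarrow> real^3 \<Rightarrow> real^3) \<Rightarrow> bool" where
  "smooth_field T u \<longleftrightarrow>
     (\<forall>k. Ck_on k ({0..<T} \<times> UNIV) (\<lambda>(t, x). u t x)) \<and>
     (\<forall>s\<ge>0. continuous_in_sobolev T s u)"


section \<open>Differential operators in space\<close>

text \<open>Partial derivatives are totalised by 0 where they do not exist.\<close>

definition partial_deriv :: "3 \<Rightarrow> (real^3 \<Rightarrow> real^3) \<Rightarrow> real^3 \<Rightarrow> real^3" where
  "partial_deriv i f x =
     (if (\<lambda>h. f (x + h *\<^sub>R axis i 1)) differentiable (at 0)
      then vector_derivative (\<lambda>h. f (x + h *\<^sub>R axis i 1)) (at 0) else 0)"

definition divergence :: "(real^3 \<Rightarrow> real^3) \<Rightarrow> real^3 \<Rightarrow> real" where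
  "divergence f x = (\<Sum>i\<in>UNIV. partial_deriv i f x $ i)"

definition curl :: "(real^3 \<Rightarrow> real^3) \<Rightarrow> real^3 \<Rightarrow> real^3" where
  "curl f x = vector
     [partial_deriv 2 f x $ 3 - partial_deriv 3 f x $ 2,
      partial_deriv 3 f x $ 1 - partial_deriv 1 f x $ 3,
      partial_deriv 1 f x $ 2 - partial_deriv 2 f x $ 1]"

definition laplacian :: "(real^3 \<Rightarrow> real^3) \<Rightarrow> real^3 \<Rightarrow> real^3" where
  "laplacian f x = (\<Sum>i\<in>UNIV. partial_deriv i (partial_deriv i f) x)"


section \<open>Fourier multipliers and projections\<close>

text \<open>Componentwise multiplier with a real symbol. Below the symbols are even, so the inverse
  transform is real and \<open>Re\<close> only changes the type. All fields to which these operators are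
  applied lie in every Sobolev space and are such that the multiplied transform is absolutely
  integrable, so the inversion integral gives the continuous representative of the result.\<close>

definition fourier_multiplier ::
    "(real^3 \<Rightarrow> real) \<Rightarrow> (real^3 \<Rightarrow> real^3) \<Rightarrow> real^3 \<Rightarrow> real^3" where
  "fourier_multiplier m f x =
     (\<chi> i. Re (inverse_fourier (\<lambda>\<xi>. complex_of_real (m \<xi>) * fourier (component f i) \<xi>) x))"

definition Lambda :: "(real^3 \<Rightarrow> real^3) \<Rightarrow> real^3 \<Rightarrow> real^3" where
  "Lambda = fourier_multiplier (\<lambda>\<xi>. norm \<xi>)"

definition Lambda_inv :: "(real^3 \<Rightarrow> real^3) \<Rightarrow> real^3 \<Rightarrow> real^3" where
  "Lambda_inv = fourier_multiplier (\<lambda>\<xi>. 1 / norm \<xi>)"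

definition neg_laplacian_inv :: "(real^3 \<Rightarrow> real^3) \<Rightarrow> real^3 \<Rightarrow> real^3" where
  "neg_laplacian_inv = fourier_multiplier (\<lambda>\<xi>. 1 / (norm \<xi>)\<^sup>2)"

definition Q :: "(real^3 \<Rightarrow> real^3) \<Rightarrow> real^3 \<Rightarrow> real^3" where
  "Q \<psi> = neg_laplacian_inv (curl (curl \<psi>))"

definition Q_plus :: "(real^3 \<Rightarrow> real^3) \<Rightarrow> real^3 \<Rightarrow> real^3" where
  "Q_plus \<phi> x = (1/2) *\<^sub>R (\<phi> x + Lambda_inv (curl \<phi>) x)"

definition Q_minus :: "(real^3 \<Rightarrow> real^3) \<Rightarrow> real^3 \<Rightarrow> real^3" where
  "Q_minus \<phi> x = (1/2) *\<^sub>R (\<phi> x - Lambda_inv (curl \<phi>) x)"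

definition P_plus :: "(real^3 \<Rightarrow> real^3) \<Rightarrow> real^3 \<Rightarrow> real^3" where
  "P_plus \<psi> = Q_plus (Q \<psi>)"

definition P_minus :: "(real^3 \<Rightarrow> real^3) \<Rightarrow> real^3 \<Rightarrow> real^3" where
  "P_minus \<psi> = Q_minus (Q \<psi>)"


section \<open>The system\<close>

definition time_deriv ::
    "real \<Rightarrow> (real \<Rightarrow> real^3 \<Rightarrow> real^3) \<Rightarrow> real \<Rightarrow> real^3 \<Rightarrow> real^3" where
  "time_deriv T u t x = vector_derivative (\<lambda>r. u r x) (at t within {0..<T})"

definition helical_pair ::
    "real \<Rightarrow> (real \<Rightarrow> real^3 \<Rightarrow> real^3) \<Rightarrow> (real \<Rightarrow> real^3 \<Rightarrow> real^3) \<Rightarrow> bool" where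
  "helical_pair T up um \<longleftrightarrow> smooth_field T up \<and> smooth_field T um \<and>
     (\<forall>t\<in>{0..<T}. \<forall>x.
        divergence (up t) x = 0 \<and> divergence (um t) x = 0 \<and>
        curl (up t) x = Lambda (up t) x \<and> curl (um t) x = - Lambda (um t) x)"

definition nonlinearity :: "(real^3 \<Rightarrow> real^3) \<Rightarrow> (real^3 \<Rightarrow> real^3) \<Rightarrow> real^3 \<Rightarrow> real^3" where
  "nonlinearity vp vm x = cross3 (vp x + vm x) (Lambda vp x - Lambda vm x)"

definition solves_system ::
    "real \<Rightarrow> real \<Rightarrow> (real \<Rightarrow> real^3 \<Rightarrow> real^3) \<Rightarrow> (real \<Rightarrow> real^3 \<Rightarrow> real^3) \<Rightarrow> bool" where
  "solves_system \<nu> T up um \<longleftrightarrow> (\<forall>t\<in>{0..<T}. \<forall>x.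
     time_deriv T up t x - \<nu> *\<^sub>R laplacian (up t) x = P_plus (nonlinearity (up t) (um t)) x \<and>
     time_deriv T um t x - \<nu> *\<^sub>R laplacian (um t) x = P_minus (nonlinearity (up t) (um t)) x)"

end

theory Submission
  imports Defs
begin

text \<open>The map in question is \<open>f \<mapsto> - f (- x)\<close> followed by an exchange of the two components. Every
  Fourier multiplier with an even symbol commutes with the reflection \<open>x \<mapsto> - x\<close>, whereas each
  first-order derivative, and so the curl, anticommutes with it. Reflection therefore preserves
  \<open>Q\<close> and \<open>Lambda\<close> but exchanges the positive and negative spectral parts of the curl:
  \<open>P_plus\<close> and \<open>P_minus\<close> are swapped (\<open>P_signed_parity\<close>), and so are the two conditions
  \<open>curl u = Lambda u\<close> and \<open>curl u = - Lambda u\<close>. Exchanging \<open>u_plus\<close> and \<open>u_minus\<close> undoes this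
  swap.

  It remains to match the signs. In the product \<open>(u_plus + u_minus) \<times> (Lambda u_plus - Lambda u_minus)\<close>
  the exchange preserves the first factor and negates the second, and a common sign of the fields
  enters quadratically and drops out. The nonlinearity is thus reflected and negated
  (\<open>nonlinearity_signed_parity\<close>). The linear terms are reflected and multiplied by the common sign,
  which must hence be \<open>- 1\<close>.

  The analytic difficulty lies in the Fourier transform, which is an arbitrarily chosen
  representative of an L2 limit. Two limits agree almost everywhere (\<open>is_fourier_unique_AE\<close>), so the
  transform of a reflected function is the reflected transform only almost everywhere
  (\<open>fourier_signed_parity_AE\<close>). This suffices, because multipliers and Sobolev norms see the
  transform only through integrals. A function and its reflection fail to have a transform or a
  partial derivative simultaneously, so the identities for the operators in space also respect
  the default values.\<close>

section \<open>Reflection with a sign\<close>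

text \<open>The sign is a parameter because a derivative turns the sign \<open>c\<close> into \<open>- c\<close>. A single lemma
  per operator then covers all the compositions that occur in \<open>P_plus\<close> and \<open>P_minus\<close>.\<close>

definition signed_parity :: "real \<Rightarrow> ('a::real_normed_vector \<Rightarrow> 'b::real_normed_vector) \<Rightarrow> 'a \<Rightarrow> 'b" where
  "signed_parity c f = (\<lambda>x. c *\<^sub>R f (- x))"

lemma signed_parity_apply: "signed_parity c f x = c *\<^sub>R f (- x)"
  by (simp add: signed_parity_def)

lemma sign_square:
  fixes c :: real
  assumes "\<bar>c\<bar> = 1"
  shows "c * c = 1"
  using assms by (auto simp: abs_if split: if_splits)

lemma signed_parity_involution:
  assumes "\<bar>c\<bar> = 1"
  shows "signed_parity c (signed_parity c f) = f"
  by (simp add: signed_parity_def fun_eq_iff sign_square[OF assms])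

lemma component_signed_parity: "component (signed_parity c f) i = signed_parity c (component f i)"
  by (simp add: component_def signed_parity_def fun_eq_iff
      scaleR_conv_of_real[where 'a = complex])

section \<open>Change of variables under reflection\<close>

lemma lborel_distr_uminus: "distr lborel borel uminus = (lborel :: 'a::euclidean_space measure)"
  using lborel_affine[of "-1" "0 :: 'a"] by (simp add: density_1)

lemma borel_measurable_reflect:
  fixes f :: "'a::euclidean_space \<Rightarrow> 'b::topological_space"
  assumes "f \<in> borel_measurable borel"
  shows "(\<lambda>x. f (- x)) \<in> borel_measurable borel"
  using measurable_compose[of uminus borel borel f borel] assms by simp

lemma borel_measurable_signed_parity:
  fixes f :: "'a::euclidean_space \<Rightarrow> 'b::{real_normed_vector, second_countable_topology}"
  assumes "f \<in> borel_measurable borel"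
  shows "signed_parity c f \<in> borel_measurable borel"
  unfolding signed_parity_def using borel_measurable_reflect[OF assms] by measurable

lemma integrable_reflect:
  fixes f :: "'a::euclidean_space \<Rightarrow> 'b::{banach, second_countable_topology}"
  assumes "integrable lborel f"
  shows "integrable lborel (\<lambda>x. f (- x))"
proof (rule integrable_distr[where T = uminus and f = f and M' = borel])
  show "uminus \<in> measurable lborel (borel :: 'a measure)" by simp
  show "integrable (distr lborel borel uminus) f"
    using assms by (simp add: lborel_distr_uminus)
qed

lemma integral_reflect:
  fixes f :: "'a::euclidean_space \<Rightarrow> 'b::{banach, second_countable_topology}"
  assumes "f \<in> borel_measurable borel"
  shows "(LINT x|lborel. f (- x)) = (LINT x|lborel. f x)"
  using integral_distr[of uminus lborel borel f] assms by (simp add: lborel_distr_uminus)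

lemma nn_integral_reflect:
  fixes f :: "'a::euclidean_space \<Rightarrow> ennreal"
  assumes "f \<in> borel_measurable borel"
  shows "(\<integral>\<^sup>+x. f (- x) \<partial>lborel) = (\<integral>\<^sup>+x. f x \<partial>lborel)"
  using nn_integral_distr[of uminus lborel borel f] assms by (simp add: lborel_distr_uminus)

section \<open>The Fourier transform of a reflected function\<close>

lemma square_integrable_measurable: "square_integrable f \<Longrightarrow> f \<in> borel_measurable borel"
  by (simp add: square_integrable_def)

lemma square_integrable_signed_parity:
  assumes "square_integrable f"
  shows "square_integrable (signed_parity c f)"
proof -
  have "integrable lborel (\<lambda>x. c\<^sup>2 * (norm (f (- x)))\<^sup>2)"
    using assms integrable_reflect[of "\<lambda>x. (norm (f x))\<^sup>2"] by (simp add: square_integrable_def)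
  then show ?thesis
    using assms borel_measurable_signed_parity[of f c]
    by (simp add: square_integrable_def signed_parity_apply power_mult_distrib)
qed

lemma truncated_fourier_measurable:
  assumes [measurable]: "f \<in> borel_measurable borel"
  shows "truncated_fourier R f \<in> borel_measurable borel"
proof -
  have [measurable]: "cball (0 :: real^3) R \<in> sets borel" by simp
  have [measurable]: "(\<lambda>p::(real^3) \<times> (real^3). cis (- (snd p \<bullet> fst p))) \<in> borel_measurable (borel \<Otimes>\<^sub>M borel)"
    unfolding borel_prod
    by (intro borel_measurable_continuous_onI continuous_intros)
  have "(\<lambda>\<xi>. LINT x|lborel. indicator (cball 0 R) x *\<^sub>R (cis (- (x \<bullet> \<xi>)) * f x)) \<in> borel_measurable borel"
  proof (rule lborel.borel_measurable_lebesgue_integral)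
    have "(\<lambda>p. indicator (cball 0 R) (snd p) *\<^sub>R (cis (- (snd p \<bullet> fst p)) * f (snd p)))
        \<in> borel_measurable (borel \<Otimes>\<^sub>M (borel :: (real^3) measure))"
      by measurable
    then show "(\<lambda>(\<xi>, x). indicator (cball 0 R) x *\<^sub>R (cis (- (x \<bullet> \<xi>)) * f x))
        \<in> borel_measurable (borel \<Otimes>\<^sub>M lborel)"
      by (simp add: case_prod_beta')
  qed
  then show ?thesis
    unfolding truncated_fourier_def set_lebesgue_integral_def by simp
qed

lemma truncated_fourier_signed_parity:
  assumes [measurable]: "f \<in> borel_measurable borel"
  shows "truncated_fourier R (signed_parity c f) = signed_parity c (truncated_fourier R f)"
proof
  fix \<xi> :: "real^3"
  let ?h = "\<lambda>x. indicator (cball 0 R) x *\<^sub>R (cis (x \<bullet> \<xi>) * f x)"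
  have [measurable]: "cball (0 :: real^3) R \<in> sets borel" by simp
  have [measurable]: "(\<lambda>x. cis (x \<bullet> \<xi>)) \<in> borel_measurable borel"
    by (intro borel_measurable_continuous_onI continuous_intros)
  have "(LINT x|lborel. indicator (cball 0 R) x *\<^sub>R (cis (- (x \<bullet> \<xi>)) * signed_parity c f x))
      = (LINT x|lborel. c *\<^sub>R ?h (- x))"
    by (rule Bochner_Integration.integral_cong)
       (auto simp: signed_parity_def indicator_def split: if_splits)
  also have "\<dots> = c *\<^sub>R (LINT x|lborel. ?h (- x))"
    by (rule integral_scaleR_right)
  also have "(LINT x|lborel. ?h (- x)) = (LINT x|lborel. ?h x)"
    by (rule integral_reflect) measurable
  finally have "(LINT x|lborel. indicator (cball 0 R) x *\<^sub>R (cis (- (x \<bullet> \<xi>)) * signed_parity c f x))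
      = c *\<^sub>R (LINT x|lborel. ?h x)" .
  then show "truncated_fourier R (signed_parity c f) \<xi> = signed_parity c (truncated_fourier R f) \<xi>"
    by (simp only: truncated_fourier_def set_lebesgue_integral_def inner_minus_right minus_minus
        signed_parity_apply[of c "truncated_fourier R f"] scaleR_left_commute)
qed

text \<open>The squared L2 distance of two limits is at most twice the sum of their squared distances
  to the same truncated transform.\<close>

lemma is_fourier_unique_AE:
  assumes "is_fourier f g" "is_fourier f h"
  shows "AE \<xi> in lborel. g \<xi> = h \<xi>"
proof -
  have [measurable]: "f \<in> borel_measurable borel" "g \<in> borel_measurable borel" "h \<in> borel_measurable borel"
    using assms by (auto simp: is_fourier_def square_integrable_measurable)
  note truncated_fourier_measurable[measurable]
  let ?D = "\<lambda>g R. \<integral>\<^sup>+\<xi>. ennreal ((norm (truncated_fourier R f \<xi> - g \<xi>))\<^sup>2) \<partial>lborel"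
  let ?I = "\<integral>\<^sup>+\<xi>. ennreal ((norm (g \<xi> - h \<xi>))\<^sup>2) \<partial>lborel"
  have bound: "?I \<le> 2 * (?D g R + ?D h R)" for R
  proof -
    have pt: "(norm (a - b))\<^sup>2 \<le> 2 * ((norm (t - a))\<^sup>2 + (norm (t - b))\<^sup>2)" for a b t :: complex
    proof -
      have "norm (a - b) \<le> norm (t - a) + norm (t - b)"
        using norm_triangle_ineq4[of "t - b" "t - a"] by simp
      then have "(norm (a - b))\<^sup>2 \<le> (norm (t - a) + norm (t - b))\<^sup>2"
        by (simp add: power_mono)
      also have "\<dots> \<le> 2 * ((norm (t - a))\<^sup>2 + (norm (t - b))\<^sup>2)"
        using zero_le_power2[of "norm (t - a) - norm (t - b)"] by (simp add: power2_eq_square algebra_simps)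
      finally show ?thesis .
    qed
    have "?I \<le> (\<integral>\<^sup>+\<xi>. 2 * (ennreal ((norm (truncated_fourier R f \<xi> - g \<xi>))\<^sup>2)
        + ennreal ((norm (truncated_fourier R f \<xi> - h \<xi>))\<^sup>2)) \<partial>lborel)"
    proof (rule nn_integral_mono)
      fix \<xi>
      have "ennreal ((norm (g \<xi> - h \<xi>))\<^sup>2) \<le> ennreal (2 * ((norm (truncated_fourier R f \<xi> - g \<xi>))\<^sup>2
          + (norm (truncated_fourier R f \<xi> - h \<xi>))\<^sup>2))"
        by (intro ennreal_leI pt)
      then show "ennreal ((norm (g \<xi> - h \<xi>))\<^sup>2) \<le> 2 * (ennreal ((norm (truncated_fourier R f \<xi> - g \<xi>))\<^sup>2)
        + ennreal ((norm (truncated_fourier R f \<xi> - h \<xi>))\<^sup>2))"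
        by (simp add: ennreal_mult)
    qed
    also have "\<dots> = 2 * (?D g R + ?D h R)"
      by (simp add: nn_integral_cmult nn_integral_add)
    finally show ?thesis .
  qed
  have "((\<lambda>R. 2 * (?D g R + ?D h R)) \<longlongrightarrow> 2 * (0 + 0)) at_top"
    using assms by (intro ennreal_tendsto_cmult tendsto_add) (auto simp: is_fourier_def)
  then have "?I \<le> 2 * (0 + 0)"
    by (rule tendsto_lowerbound) (intro always_eventually allI bound, simp)
  then have "?I = 0" by simp
  then show ?thesis
    by (subst (asm) nn_integral_0_iff_AE) auto
qed

lemma is_fourier_signed_parity:
  assumes "is_fourier f g"
  shows "is_fourier (signed_parity c f) (signed_parity c g)"
proof -
  have [measurable]: "f \<in> borel_measurable borel" "g \<in> borel_measurable borel"
    using assms by (auto simp: is_fourier_def square_integrable_measurable)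
  note truncated_fourier_measurable[measurable]
  let ?d = "\<lambda>R \<xi>. ennreal ((norm (truncated_fourier R f \<xi> - g \<xi>))\<^sup>2)"
  have "(\<integral>\<^sup>+\<xi>. ennreal ((norm (truncated_fourier R (signed_parity c f) \<xi> - signed_parity c g \<xi>))\<^sup>2) \<partial>lborel)
      = ennreal (c\<^sup>2) * (\<integral>\<^sup>+\<xi>. ?d R \<xi> \<partial>lborel)" for R
  proof -
    have "(\<integral>\<^sup>+\<xi>. ennreal ((norm (truncated_fourier R (signed_parity c f) \<xi> - signed_parity c g \<xi>))\<^sup>2) \<partial>lborel)
      = (\<integral>\<^sup>+\<xi>. ennreal (c\<^sup>2) * ?d R (- \<xi>) \<partial>lborel)"
      by (simp add: truncated_fourier_signed_parity signed_parity_apply ennreal_mult[symmetric]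
          power_mult_distrib flip: scaleR_diff_right)
    also have "\<dots> = (\<integral>\<^sup>+\<xi>. ennreal (c\<^sup>2) * ?d R \<xi> \<partial>lborel)"
      by (rule nn_integral_reflect[where f = "\<lambda>\<xi>. ennreal (c\<^sup>2) * ?d R \<xi>"]) measurable
    also have "\<dots> = ennreal (c\<^sup>2) * (\<integral>\<^sup>+\<xi>. ?d R \<xi> \<partial>lborel)"
      by (rule nn_integral_cmult) measurable
    finally show ?thesis .
  qed
  moreover have "((\<lambda>R. ennreal (c\<^sup>2) * (\<integral>\<^sup>+\<xi>. ?d R \<xi> \<partial>lborel)) \<longlongrightarrow> ennreal (c\<^sup>2) * 0) at_top"
    using assms by (intro ennreal_tendsto_cmult) (auto simp: is_fourier_def)
  ultimately show ?thesis
    using assms by (simp add: is_fourier_def square_integrable_signed_parity)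
qed

lemma is_fourier_fourier: "is_fourier f g \<Longrightarrow> is_fourier f (fourier f)"
  unfolding fourier_def by (metis someI)

lemma fourier_measurable [measurable]: "fourier f \<in> borel_measurable borel"
proof (cases "\<exists>g. is_fourier f g")
  case True
  then show ?thesis
    using is_fourier_fourier by (auto simp: is_fourier_def square_integrable_measurable)
qed (simp add: fourier_def)

text \<open>The sign is invertible, so reflection is an involution and \<open>f\<close> has a transform exactly if
  its reflection has one. If neither has one, both transforms take the default value 0.\<close>

lemma fourier_signed_parity_AE:
  assumes "\<bar>c\<bar> = 1"
  shows "AE \<xi> in lborel. fourier (signed_parity c f) \<xi> = signed_parity c (fourier f) \<xi>"
proof (cases "\<exists>g. is_fourier f g")
  case True
  then have "is_fourier (signed_parity c f) (signed_parity c (fourier f))"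
    using is_fourier_fourier is_fourier_signed_parity by blast
  then show ?thesis
    using is_fourier_fourier is_fourier_unique_AE by blast
next
  case False
  then have "\<not> (\<exists>g. is_fourier (signed_parity c f) g)"
    using is_fourier_signed_parity[of "signed_parity c f" _ c] by (auto simp: signed_parity_involution[OF assms])
  with False have "fourier f = (\<lambda>_. 0)" "fourier (signed_parity c f) = (\<lambda>_. 0)"
    by (simp_all add: fourier_def)
  then show ?thesis
    by (simp add: signed_parity_def)
qed

section \<open>Fourier multipliers and Sobolev norms\<close>

lemma inverse_fourier_signed_parity:
  assumes [measurable]: "g \<in> borel_measurable borel"
  shows "inverse_fourier (signed_parity c g) x = c *\<^sub>R inverse_fourier g (- x)"
proof -
  let ?h = "\<lambda>\<xi>. cis (- x \<bullet> \<xi>) * g \<xi>"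
  have [measurable]: "(\<lambda>\<xi>. cis (- x \<bullet> \<xi>)) \<in> borel_measurable borel"
    by (intro borel_measurable_continuous_onI continuous_intros)
  have "(LINT \<xi>|lborel. cis (x \<bullet> \<xi>) * signed_parity c g \<xi>) = (LINT \<xi>|lborel. c *\<^sub>R ?h (- \<xi>))"
    by (simp add: signed_parity_def)
  also have "\<dots> = c *\<^sub>R (LINT \<xi>|lborel. ?h (- \<xi>))"
    by (rule integral_scaleR_right)
  also have "(LINT \<xi>|lborel. ?h (- \<xi>)) = (LINT \<xi>|lborel. ?h \<xi>)"
    by (rule integral_reflect) measurable
  finally show ?thesis
    by (simp add: inverse_fourier_def scaleR_left_commute)
qed

text \<open>The inversion integral depends on its integrand only up to null sets, so the almost everywhere
  identity for the transforms becomes an identity at every point.\<close>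

lemma fourier_multiplier_signed_parity:
  assumes c: "\<bar>c\<bar> = 1"
    and [measurable]: "m \<in> borel_measurable borel"
    and even: "\<And>\<xi>. m (- \<xi>) = m \<xi>"
  shows "fourier_multiplier m (signed_parity c f) = signed_parity c (fourier_multiplier m f)"
proof
  fix x
  have "inverse_fourier (\<lambda>\<xi>. complex_of_real (m \<xi>) * fourier (component (signed_parity c f) i) \<xi>) x
      = c *\<^sub>R inverse_fourier (\<lambda>\<xi>. complex_of_real (m \<xi>) * fourier (component f i) \<xi>) (- x)"
    (is "inverse_fourier ?G x = c *\<^sub>R inverse_fourier ?g (- x)") for i
  proof -
    have [measurable]: "(\<lambda>\<xi>. cis (x \<bullet> \<xi>)) \<in> borel_measurable borel"
      by (intro borel_measurable_continuous_onI continuous_intros)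
    have g [measurable]: "?g \<in> borel_measurable borel"
      by measurable
    have [measurable]: "signed_parity c ?g \<in> borel_measurable borel"
      by (rule borel_measurable_signed_parity) (rule g)
    have "AE \<xi> in lborel. ?G \<xi> = signed_parity c ?g \<xi>"
      using fourier_signed_parity_AE[OF c, of "component f i"]
      by eventually_elim (simp only: component_signed_parity signed_parity_apply even mult_scaleR_right)
    then have "AE \<xi> in lborel. cis (x \<bullet> \<xi>) * ?G \<xi> = cis (x \<bullet> \<xi>) * signed_parity c ?g \<xi>"
      by eventually_elim simp
    then have "inverse_fourier ?G x = inverse_fourier (signed_parity c ?g) x"
      unfolding inverse_fourier_def
      by (intro arg_cong[where f = "\<lambda>z. _ *\<^sub>R z"] integral_cong_AE) measurable
    then show ?thesis
      by (simp add: inverse_fourier_signed_parity[OF g])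
  qed
  then show "fourier_multiplier m (signed_parity c f) x = signed_parity c (fourier_multiplier m f) x"
    by (simp add: fourier_multiplier_def signed_parity_def vec_eq_iff)
qed

lemma sobolev_density_signed_parity_AE:
  assumes "\<bar>c\<bar> = 1"
  shows "AE \<xi> in lborel. (1 + (norm \<xi>)\<^sup>2) powr s * (norm (fourier (component (signed_parity c f) i) \<xi>))\<^sup>2
    = (1 + (norm (- \<xi>))\<^sup>2) powr s * (norm (fourier (component f i) (- \<xi>)))\<^sup>2"
  using fourier_signed_parity_AE[OF assms, of "component f i"]
  by eventually_elim (simp only: component_signed_parity signed_parity_apply norm_scaleR norm_minus_cancel
      assms mult_1)

lemma sobolev_density_measurable:
  "(\<lambda>\<xi>. (1 + (norm \<xi>)\<^sup>2) powr s * (norm (fourier (component f i) \<xi>))\<^sup>2) \<in> borel_measurable borel"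
  by measurable

lemma in_sobolev_signed_parity:
  assumes c: "\<bar>c\<bar> = 1" and "in_sobolev s f"
  shows "in_sobolev s (signed_parity c f)"
  unfolding in_sobolev_def
proof (intro allI conjI)
  fix i
  show "square_integrable (component (signed_parity c f) i)"
    using assms by (simp add: component_signed_parity square_integrable_signed_parity in_sobolev_def)
  let ?F = "\<lambda>f \<xi>. (1 + (norm \<xi>)\<^sup>2) powr s * (norm (fourier (component f i) \<xi>))\<^sup>2"
  have "integrable lborel (\<lambda>\<xi>. ?F f (- \<xi>))"
    using assms by (intro integrable_reflect[where f = "?F f"]) (simp add: in_sobolev_def)
  then show "integrable lborel (?F (signed_parity c f))"
  proof (rule integrable_cong_AE_imp)
    show "?F (signed_parity c f) \<in> borel_measurable lborel"
      by (simp add: sobolev_density_measurable)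
    show "AE \<xi> in lborel. ?F f (- \<xi>) = ?F (signed_parity c f) \<xi>"
      using sobolev_density_signed_parity_AE[OF c, of s f i] by eventually_elim (rule sym)
  qed
qed

lemma sobolev_norm_signed_parity:
  assumes c: "\<bar>c\<bar> = 1"
  shows "sobolev_norm s (signed_parity c f) = sobolev_norm s f"
proof -
  let ?F = "\<lambda>f i \<xi>. (1 + (norm \<xi>)\<^sup>2) powr s * (norm (fourier (component f i) \<xi>))\<^sup>2"
  have "(LINT \<xi>|lborel. ?F (signed_parity c f) i \<xi>) = (LINT \<xi>|lborel. ?F f i \<xi>)" for i
  proof -
    have "(LINT \<xi>|lborel. ?F (signed_parity c f) i \<xi>) = (LINT \<xi>|lborel. ?F f i (- \<xi>))"
      using sobolev_density_signed_parity_AE[OF c, of s f i]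
        borel_measurable_reflect[OF sobolev_density_measurable[of s f i]]
      by (intro integral_cong_AE) (auto simp: sobolev_density_measurable)
    also have "\<dots> = (LINT \<xi>|lborel. ?F f i \<xi>)"
      by (rule integral_reflect[OF sobolev_density_measurable])
    finally show ?thesis .
  qed
  then show ?thesis
    by (simp add: sobolev_norm_def)
qed

lemma continuous_in_sobolev_signed_parity:
  assumes c: "\<bar>c\<bar> = 1" and u: "continuous_in_sobolev T s u"
  shows "continuous_in_sobolev T s (\<lambda>t. signed_parity c (u t))"
proof -
  have "(\<lambda>x. signed_parity c (u r) x - signed_parity c (u t) x) = signed_parity c (\<lambda>x. u r x - u t x)" for r t
    by (simp add: signed_parity_def fun_eq_iff scaleR_diff_right)
  then show ?thesis
    using u by (simp add: continuous_in_sobolev_def in_sobolev_signed_parity[OF c] sobolev_norm_signed_parity[OF c])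
qed

section \<open>Smoothness and differential operators\<close>

text \<open>A directional derivative of the composition is again a scaled composition with \<open>L\<close>, namely
  that of the derivative of \<open>f\<close> in the direction \<open>L v\<close>. This makes the induction hypothesis apply,
  provided it ranges over all functions.\<close>

lemma Ck_on_compose_linear:
  fixes f :: "'a::real_normed_vector \<Rightarrow> 'b::real_normed_vector"
  assumes L: "bounded_linear L" and LS: "L ` S \<subseteq> S"
  shows "Ck_on k S f \<Longrightarrow> Ck_on k S (\<lambda>x. c *\<^sub>R f (L x))"
proof (induction k arbitrary: f)
  case 0
  then have "continuous_on S (\<lambda>x. f (L x))"
    using continuous_on_compose2[of S f S L] linear_continuous_on[OF L] LS by simp
  then show ?case
    by (simp add: continuous_on_scaleR)
next
  case (Suc k)
  then obtain D where D: "\<And>x. x \<in> S \<Longrightarrow> (f has_derivative D x) (at x within S)"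
    and Ck: "\<And>v. Ck_on k S (\<lambda>x. D x v)"
    by auto
  have "((\<lambda>x. c *\<^sub>R f (L x)) has_derivative (\<lambda>v. c *\<^sub>R D (L x) (L v))) (at x within S)" if "x \<in> S" for x
  proof -
    have "L x \<in> S" using that LS by auto
    then have "(f has_derivative D (L x)) (at (L x) within L ` S)"
      using D has_derivative_subset LS by blast
    from has_derivative_in_compose[OF bounded_linear_imp_has_derivative[OF L] this]
    show ?thesis by (rule has_derivative_scaleR_right)
  qed
  then show ?case
    using Suc.IH[OF Ck] by (auto intro!: exI[where x = "\<lambda>x v. c *\<^sub>R D (L x) (L v)"])
qed

lemma smooth_field_signed_parity:
  assumes c: "\<bar>c\<bar> = 1" and u: "smooth_field T u"
  shows "smooth_field T (\<lambda>t. signed_parity c (u t))"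
proof -
  let ?L = "\<lambda>p::real \<times> (real^3). (fst p, - snd p)"
  have L: "bounded_linear ?L"
    by (intro bounded_linear_Pair bounded_linear_fst bounded_linear_minus bounded_linear_snd)
  have LS: "?L ` ({0..<T} \<times> UNIV) \<subseteq> {0..<T} \<times> UNIV" by auto
  have "Ck_on k ({0..<T} \<times> UNIV) (\<lambda>(t, x). signed_parity c (u t) x)" for k
    using Ck_on_compose_linear[OF L LS, of k "\<lambda>(t, x). u t x" c] u
    by (auto simp: smooth_field_def signed_parity_def case_prod_beta')
  then show ?thesis
    using u continuous_in_sobolev_signed_parity[OF c] by (simp add: smooth_field_def)
qed

text \<open>Smoothness is used here: where the derivative does not exist, \<open>vector_derivative\<close> is an
  unspecified value that need not respect a sign.\<close>

lemma time_deriv_signed_parity: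
  assumes u: "smooth_field T u" and t: "t \<in> {0..<T}"
  shows "time_deriv T (\<lambda>t. signed_parity c (u t)) t x = c *\<^sub>R time_deriv T u t (- x)"
proof -
  let ?S = "{0..<T} \<times> (UNIV :: (real^3) set)"
  have "Ck_on (Suc 0) ?S (\<lambda>(t, x). u t x)"
    using u by (simp add: smooth_field_def del: Ck_on.simps)
  then obtain D where D: "((\<lambda>(t, x). u t x) has_derivative D) (at (t, - x) within ?S)"
    using t by fastforce
  have "((\<lambda>r. (r, - x)) has_vector_derivative (1, 0)) (at t within {0..<T})"
    by (intro has_vector_derivative_Pair derivative_eq_intros) auto
  then have i: "((\<lambda>r. (r, - x)) has_derivative (\<lambda>h. h *\<^sub>R (1, 0))) (at t within {0..<T})"
    by (simp add: has_vector_derivative_def)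
  have "(\<lambda>r. (r, - x)) ` {0..<T} \<subseteq> ?S" by auto
  with D have "((\<lambda>(t, x). u t x) has_derivative D) (at (t, - x) within (\<lambda>r. (r, - x)) ` {0..<T})"
    by (rule has_derivative_subset)
  from has_derivative_in_compose[OF i this]
  have "(\<lambda>r. u r (- x)) differentiable (at t within {0..<T})"
    by (auto simp: differentiable_def)
  then have d: "((\<lambda>r. u r (- x)) has_vector_derivative time_deriv T u t (- x)) (at t within {0..<T})"
    by (simp add: vector_derivative_works time_deriv_def)
  have nb: "at t within {0..<T} \<noteq> bot"
    using islimpt_subset[OF islimpt_greaterThanLessThan1[of t T], of "{0..<T}"] t
    by (auto simp: trivial_limit_within)
  show ?thesis
    unfolding time_deriv_def[of T "\<lambda>t. signed_parity c (u t)"] signed_parity_apply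
    by (rule vector_derivative_within[OF nb bounded_linear.has_vector_derivative[OF bounded_linear_scaleR_right d]])
qed

text \<open>The chain rule for \<open>h \<mapsto> - h\<close> contributes the additional sign. Applied to the inverse
  reflection it also shows that differentiability is equivalent for \<open>f\<close> and its reflection, so that
  the identity includes the points where both partial derivatives are set to 0.\<close>

lemma partial_deriv_signed_parity:
  assumes "c \<noteq> 0"
  shows "partial_deriv i (signed_parity c f) = signed_parity (- c) (partial_deriv i f)"
proof
  fix x
  have chain: "((\<lambda>h. signed_parity b g (y + h *\<^sub>R axis i 1)) has_vector_derivative - (b *\<^sub>R v)) (at 0)"
    if "((\<lambda>h. g (- y + h *\<^sub>R axis i 1)) has_vector_derivative v) (at 0)"
    for b v y and g :: "real^3 \<Rightarrow> real^3"
  proof -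
    have "((\<lambda>h. - h :: real) has_vector_derivative - 1) (at 0)"
      by (auto intro!: derivative_eq_intros)
    from vector_diff_chain_at[OF this, of "\<lambda>h. g (- y + h *\<^sub>R axis i 1)" v] that
    have "((\<lambda>h. g (- y + (- h) *\<^sub>R axis i 1)) has_vector_derivative - v) (at 0)"
      by (simp only: o_def scaleR_minus_left scaleR_one minus_zero)
    from bounded_linear.has_vector_derivative[OF bounded_linear_scaleR_right this]
    show ?thesis
      by (simp add: signed_parity_def)
  qed
  let ?f = "\<lambda>h. f (- x + h *\<^sub>R axis i 1)" and ?g = "\<lambda>h. signed_parity c f (x + h *\<^sub>R axis i 1)"
  have iff: "?g differentiable at 0 \<longleftrightarrow> ?f differentiable at 0"
  proof
    assume "?f differentiable at 0"
    then show "?g differentiable at 0"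
      using chain[of f x _ c] vector_derivative_works differentiableI_vector by blast
  next
    assume "?g differentiable at 0"
    then obtain v where "(?g has_vector_derivative v) (at 0)"
      using vector_derivative_works by blast
    with chain[of "signed_parity c f" "- x" v "inverse c"]
    have "((\<lambda>h. signed_parity (inverse c) (signed_parity c f) (- x + h *\<^sub>R axis i 1))
        has_vector_derivative - (inverse c *\<^sub>R v)) (at 0)"
      by simp
    moreover have "signed_parity (inverse c) (signed_parity c f) = f"
      using assms by (simp add: signed_parity_def fun_eq_iff)
    ultimately show "?f differentiable at 0"
      by (metis differentiableI_vector)
  qed
  show "partial_deriv i (signed_parity c f) x = signed_parity (- c) (partial_deriv i f) x"
  proof (cases "?f differentiable at 0")
    case True
    then have "(?f has_vector_derivative vector_derivative ?f (at 0)) (at 0)"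
      by (simp add: vector_derivative_works)
    from chain[OF this, of c] have "vector_derivative ?g (at 0) = - (c *\<^sub>R vector_derivative ?f (at 0))"
      by (rule vector_derivative_at)
    with True iff show ?thesis
      by (simp add: partial_deriv_def signed_parity_apply)
  next
    case False
    with iff show ?thesis
      by (simp add: partial_deriv_def signed_parity_apply)
  qed
qed

lemma divergence_signed_parity:
  "c \<noteq> 0 \<Longrightarrow> divergence (signed_parity c f) x = - c * divergence f (- x)"
  by (simp add: divergence_def partial_deriv_signed_parity signed_parity_apply sum_negf sum_distrib_left)

lemma curl_signed_parity:
  assumes "c \<noteq> 0"
  shows "curl (signed_parity c f) = signed_parity (- c) (curl f)"
  using assms
  by (simp add: fun_eq_iff curl_def partial_deriv_signed_parity signed_parity_apply vec_eq_iff forall_3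
      algebra_simps)

lemma laplacian_signed_parity:
  "c \<noteq> 0 \<Longrightarrow> laplacian (signed_parity c f) = signed_parity c (laplacian f)"
  by (simp add: fun_eq_iff laplacian_def partial_deriv_signed_parity signed_parity_apply scaleR_sum_right)

section \<open>The operators of the system\<close>

lemma Lambda_signed_parity:
  "\<bar>c\<bar> = 1 \<Longrightarrow> Lambda (signed_parity c f) = signed_parity c (Lambda f)"
  unfolding Lambda_def by (rule fourier_multiplier_signed_parity) auto

lemma Lambda_inv_signed_parity:
  "\<bar>c\<bar> = 1 \<Longrightarrow> Lambda_inv (signed_parity c f) = signed_parity c (Lambda_inv f)"
  unfolding Lambda_inv_def by (rule fourier_multiplier_signed_parity) auto

lemma Q_signed_parity:
  assumes c: "\<bar>c\<bar> = 1"
  shows "Q (signed_parity c f) = signed_parity c (Q f)"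
proof -
  have "c \<noteq> 0" using c by auto
  then have "curl (curl (signed_parity c f)) = signed_parity c (curl (curl f))"
    by (simp add: curl_signed_parity)
  moreover have "neg_laplacian_inv (signed_parity c g) = signed_parity c (neg_laplacian_inv g)" for g
    unfolding neg_laplacian_inv_def using c by (rule fourier_multiplier_signed_parity) auto
  ultimately show ?thesis
    by (simp add: Q_def)
qed

text \<open>The operator \<open>Q\<close> contains two curls and keeps the sign. The term \<open>Lambda_inv (curl \<phi>)\<close> contains
  one and changes it relative to \<open>\<phi>\<close>, which turns \<open>Q_plus\<close> into \<open>Q_minus\<close> and conversely.\<close>

lemma P_signed_parity:
  assumes c: "\<bar>c\<bar> = 1"
  shows P_plus_signed_parity: "P_plus (signed_parity c f) = signed_parity c (P_minus f)"
    and P_minus_signed_parity: "P_minus (signed_parity c f) = signed_parity c (P_plus f)"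
proof -
  have "c \<noteq> 0" using c by auto
  then have "Lambda_inv (curl (signed_parity c g)) = signed_parity (- c) (Lambda_inv (curl g))" for g
    using c by (simp add: curl_signed_parity Lambda_inv_signed_parity)
  then show "P_plus (signed_parity c f) = signed_parity c (P_minus f)"
    and "P_minus (signed_parity c f) = signed_parity c (P_plus f)"
    by (simp_all add: fun_eq_iff P_plus_def P_minus_def Q_plus_def Q_minus_def Q_signed_parity[OF c]
        signed_parity_apply scaleR_add_right scaleR_diff_right mult.commute)
qed

text \<open>The sign \<open>- 1\<close> comes from exchanging \<open>vp\<close> and \<open>vm\<close> in the second factor; the two factors
  together contribute \<open>c\<^sup>2 = 1\<close>.\<close>

lemma nonlinearity_signed_parity:
  assumes c: "\<bar>c\<bar> = 1"
  shows "nonlinearity (signed_parity c vm) (signed_parity c vp) = signed_parity (- 1) (nonlinearity vp vm)"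
proof
  fix x
  have "nonlinearity (signed_parity c vm) (signed_parity c vp) x
     = cross3 (c *\<^sub>R (vp (- x) + vm (- x))) ((- c) *\<^sub>R (Lambda vp (- x) - Lambda vm (- x)))"
    by (simp add: nonlinearity_def Lambda_signed_parity[OF c] signed_parity_apply algebra_simps)
  also have "\<dots> = (- (c * c)) *\<^sub>R nonlinearity vp vm (- x)"
    by (simp add: nonlinearity_def cross_mult_left cross_mult_right)
  finally show "nonlinearity (signed_parity c vm) (signed_parity c vp) x
      = signed_parity (- 1) (nonlinearity vp vm) x"
    by (simp add: sign_square[OF c] signed_parity_apply)
qed

lemma helical_pair_signed_parity:
  assumes c: "\<bar>c\<bar> = 1" and "helical_pair T up um"
  shows "helical_pair T (\<lambda>t. signed_parity c (um t)) (\<lambda>t. signed_parity c (up t))"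
proof -
  have "c \<noteq> 0" using c by auto
  with assms show ?thesis
    by (simp add: helical_pair_def smooth_field_signed_parity divergence_signed_parity
        curl_signed_parity Lambda_signed_parity signed_parity_apply)
qed

text \<open>The linear side of each equation acquires the sign of the transformation and the
  nonlinearity always acquires \<open>- 1\<close>, which singles out this sign.\<close>

lemma solves_system_signed_parity:
  assumes "smooth_field T up" "smooth_field T um" "solves_system \<nu> T up um"
  shows "solves_system \<nu> T (\<lambda>t. signed_parity (- 1) (um t)) (\<lambda>t. signed_parity (- 1) (up t))"
  using assms
  by (simp add: solves_system_def time_deriv_signed_parity laplacian_signed_parity
      nonlinearity_signed_parity P_signed_parity signed_parity_apply algebra_simps)

theorem mainTheorem2:
  fixes \<nu> T :: real
    and u_plus u_minus :: "real \<Rightarrow> real^3 \<Rightarrow> real^3"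
  assumes "\<nu> \<ge> 0" and "T > 0"
    and "helical_pair T u_plus u_minus"
    and "solves_system \<nu> T u_plus u_minus"
  shows "helical_pair T (\<lambda>t x. - u_minus t (- x)) (\<lambda>t x. - u_plus t (- x)) \<and>
         solves_system \<nu> T (\<lambda>t x. - u_minus t (- x)) (\<lambda>t x. - u_plus t (- x))"
proof -
  have "(\<lambda>t x. - u t (- x)) = (\<lambda>t. signed_parity (- 1) (u t))" for u :: "real \<Rightarrow> real^3 \<Rightarrow> real^3"
    by (simp add: signed_parity_def)
  moreover have "smooth_field T u_plus" "smooth_field T u_minus"
    using assms(3) by (simp_all add: helical_pair_def)
  ultimately show ?thesis
    using helical_pair_signed_parity[of "- 1"] solves_system_signed_parity assms(3,4) by simp
qed

end
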